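(* The PG-Kmeans algorithm (Policy-Guided K-means, described in the context), applied to a dataset of $N$ trajectories with $k$ clusters, is guaranteed to converge in $O(k^N)$ iterations.
   Context: The dataset is $\mathcal{D}=\{\tau_1,\dots,\tau_N\}$, where each trajectory $\tau_i=\{(s_{i,h},a_{i,h})\}_{h=1}^H$ is a sequence of state-action pairs of horizon $H$ in a Markov decision process. There are $k$ policies $\pi_1,\dots,\pi_k$, where $\pi_j$ has parameters $\theta_j$; write $\theta=(\theta_1,\dots,\theta_k)$. $\mathbb{P}(a\mid\theta_j,s)$ is the probability that the policy with parameters $\theta_j$ takes action $a$ in state $s$, and $\mathbb{P}(\tau\mid\theta_j)$ is the probability of the trajectory $\tau$ under that policy (the environment dynamics do not depend on $\theta_j$). An assignment matrix is $W=(w_{i,j})$ with $w_{i,j}\in\{0,1\}$ for $(i,j)\in[N]\times[k]$ and $\sum_{j=1}^k w_{i,j}=1$ for every $i\in[N]$; $w_i$ denotes its $i$-th row. The objective to be maximized is $$J(W,\theta)=\sum_{i=1}^N\sum_{j=1}^k w_{i,j}\sum_{h=1}^H\log\mathbb{P}(a_{i,h}\mid\theta_j,s_{i,h}).$$ PG-Kmeans takes as input $\mathcal{D}$, the number of clusters $k$ and a maximum number of iterations. It initializes the cluster assignments $W$ randomly and initializes the $k$ policies by behavior cloning trained on the respective clusters. It then repeats the following iteration: (M-step) update each policy $\pi_j$ by training a behavior cloning model on the trajectories assigned to cluster $j$, i.e. each cluster center is updated to maximize the likelihood of generating its assigned trajectories, so that $\theta$ maximizes $J(W,\cdot)$ for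 the current $W$; (E-step) assign each trajectory $\tau_i\in\mathcal{D}$ to the cluster $j=\arg\max_{j'}\mathbb{P}(\tau_i\mid\theta_{j'})$, i.e. set $w_i=e_j$, where $e_j$ is a one-hot vector; (Convergence check) if the cluster assignments $W$ remain unchanged, terminate. The algorithm converges when the convergence check is met. (After this loop the algorithm may optionally merge clusters; this is not part of the iteration.)
   Formalization: Added: arg-max ties are broken consistently (a trajectory whose cluster is already a maximizer never moves to one of larger fixed rank), the initial objective J is finite (log 0 = -infinity), and every dataset trajectory has positive probability under the environment dynamics. *)

theory Defs
  imports "HOL-Probability.Probability_Mass_Function"
begin

text \<open>
  A Markov decision process is given by its initial distribution \<open>\<rho>\<close> and its transition kernel
  \<open>T\<close>; \<open>P \<eta> s\<close> is the action distribution in state \<open>s\<close> of the policy with parameters \<open>\<eta>\<close>.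
  Time steps, trajectories and clusters are numbered from 0.
\<close>

type_synonym ('s, 'a) trajectory = "('s \<times> 'a) list"

definition env_prob :: "'s pmf \<Rightarrow> ('s \<Rightarrow> 'a \<Rightarrow> 's pmf) \<Rightarrow> ('s, 'a) trajectory \<Rightarrow> real" where
  "env_prob \<rho> T \<tau> =
     pmf \<rho> (fst (\<tau> ! 0)) *
     (\<Prod>h<length \<tau> - 1. pmf (T (fst (\<tau> ! h)) (snd (\<tau> ! h))) (fst (\<tau> ! Suc h)))"

definition traj_prob ::
  "'s pmf \<Rightarrow> ('s \<Rightarrow> 'a \<Rightarrow> 's pmf) \<Rightarrow> ('p \<Rightarrow> 's \<Rightarrow> 'a pmf) \<Rightarrow> 'p \<Rightarrow> ('s, 'a) trajectory \<Rightarrow> real" where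
  "traj_prob \<rho> T P \<eta> \<tau> =
     env_prob \<rho> T \<tau> * (\<Prod>h<length \<tau>. pmf (P \<eta> (fst (\<tau> ! h))) (snd (\<tau> ! h)))"

definition is_assignment :: "nat \<Rightarrow> nat \<Rightarrow> (nat \<Rightarrow> nat \<Rightarrow> nat) \<Rightarrow> bool" where
  "is_assignment N k W \<longleftrightarrow>
     (\<forall>i<N. (\<forall>j<k. W i j \<in> {0, 1}) \<and> (\<Sum>j<k. W i j) = 1)"

definition same_assignment ::
  "nat \<Rightarrow> nat \<Rightarrow> (nat \<Rightarrow> nat \<Rightarrow> nat) \<Rightarrow> (nat \<Rightarrow> nat \<Rightarrow> nat) \<Rightarrow> bool" where
  "same_assignment N k W W' \<longleftrightarrow> (\<forall>i<N. \<forall>j<k. W i j = W' i j)"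

text \<open>
  Since \<open>ln 0 = 0\<close> for the library logarithm, the logarithm of a probability is taken in the
  extended reals with \<open>log 0 = - \<infinity>\<close>. All summands of the objective are then in \<open>[-\<infinity>, 0]\<close>, and
  the convention \<open>0 * (- \<infinity>) = 0\<close> of \<^typ>\<open>ereal\<close> removes the clusters a trajectory is not
  assigned to.
\<close>

definition log_prob :: "real \<Rightarrow> ereal" where
  "log_prob p = (if p = 0 then - \<infinity> else ereal (ln p))"

definition objective ::
  "('p \<Rightarrow> 's \<Rightarrow> 'a pmf) \<Rightarrow> ('s, 'a) trajectory list \<Rightarrow> nat \<Rightarrow>
   (nat \<Rightarrow> nat \<Rightarrow> nat) \<Rightarrow> (nat \<Rightarrow> 'p) \<Rightarrow> ereal" where
  "objective P D k W \<theta> =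
     (\<Sum>i<length D. \<Sum>j<k. ereal (real (W i j)) *
        (\<Sum>h<length (D ! i). log_prob (pmf (P (\<theta> j) (fst (D ! i ! h))) (snd (D ! i ! h)))))"

definition M_step ::
  "('p \<Rightarrow> 's \<Rightarrow> 'a pmf) \<Rightarrow> ('s, 'a) trajectory list \<Rightarrow> nat \<Rightarrow>
   (nat \<Rightarrow> nat \<Rightarrow> nat) \<Rightarrow> (nat \<Rightarrow> 'p) \<Rightarrow> bool" where
  "M_step P D k W \<theta> \<longleftrightarrow> is_arg_max (objective P D k W) (\<lambda>_. True) \<theta>"

definition best_cluster ::
  "'s pmf \<Rightarrow> ('s \<Rightarrow> 'a \<Rightarrow> 's pmf) \<Rightarrow> ('p \<Rightarrow> 's \<Rightarrow> 'a pmf) \<Rightarrow> nat \<Rightarrow>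
   (nat \<Rightarrow> 'p) \<Rightarrow> ('s, 'a) trajectory \<Rightarrow> nat \<Rightarrow> bool" where
  "best_cluster \<rho> T P k \<theta> \<tau> j \<longleftrightarrow>
     is_arg_max (\<lambda>j'. traj_prob \<rho> T P (\<theta> j') \<tau>) (\<lambda>j'. j' < k) j"

definition E_step ::
  "'s pmf \<Rightarrow> ('s \<Rightarrow> 'a \<Rightarrow> 's pmf) \<Rightarrow> ('p \<Rightarrow> 's \<Rightarrow> 'a pmf) \<Rightarrow> ('s, 'a) trajectory list \<Rightarrow>
   nat \<Rightarrow> (nat \<Rightarrow> 'p) \<Rightarrow> (nat \<Rightarrow> nat \<Rightarrow> nat) \<Rightarrow> bool" where
  "E_step \<rho> T P D k \<theta> W \<longleftrightarrow>
     (\<forall>i<length D. \<exists>j. best_cluster \<rho> T P k \<theta> (D ! i) j \<and>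
        (\<forall>j'<k. W i j' = (if j' = j then 1 else 0)))"

text \<open>
  If ties in the arg max are resolved arbitrarily, the iteration need not terminate: two identical
  trajectories in two clusters with equal policies can swap their clusters forever. The condition
  below, for an injective ranking \<open>r\<close> of the clusters (\<open>W\<close> and \<open>W'\<close> are the assignments before and
  after the E-step), only restricts trajectories whose present cluster already attains the maximum.
  It is satisfied if the maximizer of smallest rank is chosen (in particular the one of smallest
  index), and also if a trajectory keeps its cluster whenever that cluster is a maximizer.
\<close>

definition consistent_ties ::
  "(nat \<Rightarrow> nat) \<Rightarrow> 's pmf \<Rightarrow> ('s \<Rightarrow> 'a \<Rightarrow> 's pmf) \<Rightarrow> ('p \<Rightarrow> 's \<Rightarrow> 'a pmf) \<Rightarrow>
   ('s, 'a) trajectory list \<Rightarrow> nat \<Rightarrow> (nat \<Rightarrow> 'p) \<Rightarrow>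
   (nat \<Rightarrow> nat \<Rightarrow> nat) \<Rightarrow> (nat \<Rightarrow> nat \<Rightarrow> nat) \<Rightarrow> bool" where
  "consistent_ties r \<rho> T P D k \<theta> W W' \<longleftrightarrow>
     (\<forall>i<length D. \<forall>j<k. \<forall>j'<k.
        W i j = 1 \<and> W' i j' = 1 \<and> best_cluster \<rho> T P k \<theta> (D ! i) j \<longrightarrow> r j' \<le> r j)"

definition converged_at ::
  "('s, 'a) trajectory list \<Rightarrow> nat \<Rightarrow> (nat \<Rightarrow> nat \<Rightarrow> nat \<Rightarrow> nat) \<Rightarrow> nat \<Rightarrow> bool" where
  "converged_at D k W t \<longleftrightarrow> 1 \<le> t \<and> same_assignment (length D) k (W t) (W (t - 1))"

text \<open>
  \<open>W t\<close> and \<open>\<theta> t\<close> are the assignment and the parameters after \<open>t\<close> iterations. The algorithm stops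
  at the first iteration whose convergence check succeeds; the values of \<open>W\<close> and \<open>\<theta>\<close> beyond that
  iteration are unconstrained.
\<close>

definition pg_kmeans_run ::
  "(nat \<Rightarrow> nat) \<Rightarrow> 's pmf \<Rightarrow> ('s \<Rightarrow> 'a \<Rightarrow> 's pmf) \<Rightarrow> ('p \<Rightarrow> 's \<Rightarrow> 'a pmf) \<Rightarrow>
   ('s, 'a) trajectory list \<Rightarrow> nat \<Rightarrow>
   (nat \<Rightarrow> nat \<Rightarrow> nat \<Rightarrow> nat) \<Rightarrow> (nat \<Rightarrow> nat \<Rightarrow> 'p) \<Rightarrow> bool" where
  "pg_kmeans_run r \<rho> T P D k W \<theta> \<longleftrightarrow>
     is_assignment (length D) k (W 0) \<and> M_step P D k (W 0) (\<theta> 0) \<and>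
     (\<forall>t. (\<forall>s\<le>t. \<not> converged_at D k W s) \<longrightarrow>
        M_step P D k (W t) (\<theta> (Suc t)) \<and>
        E_step \<rho> T P D k (\<theta> (Suc t)) (W (Suc t)) \<and>
        consistent_ties r \<rho> T P D k (\<theta> (Suc t)) (W t) (W (Suc t)))"

end

theory Submission
  imports Defs
begin

text \<open>
  Both steps weakly increase the likelihood of the data. If the maximal likelihood for the current
  assignment does not increase in an iteration, then every trajectory's old cluster was already a
  best one, so \<open>consistent_ties\<close> makes the total rank of the assigned clusters drop unless the
  assignment is unchanged. Hence the pair (maximal likelihood, total rank) moves strictly in a
  lexicographic order until convergence. As this pair depends only on the assignment, no assignment
  recurs, and there are \<open>k ^ N\<close> of them. Working with likelihoods, which are products of reals,
  instead of their extended-real logarithms, lets the equality case be settled without treating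
  \<open>- \<infinity>\<close> separately.
\<close>

definition action_lik :: "('p \<Rightarrow> 's \<Rightarrow> 'a pmf) \<Rightarrow> 'p \<Rightarrow> ('s, 'a) trajectory \<Rightarrow> real" where
  "action_lik P \<eta> \<tau> = (\<Prod>h<length \<tau>. pmf (P \<eta> (fst (\<tau> ! h))) (snd (\<tau> ! h)))"

definition data_lik ::
  "('p \<Rightarrow> 's \<Rightarrow> 'a pmf) \<Rightarrow> ('s, 'a) trajectory list \<Rightarrow> (nat \<Rightarrow> nat) \<Rightarrow> (nat \<Rightarrow> 'p) \<Rightarrow> real" where
  "data_lik P D c \<theta> = (\<Prod>i<length D. action_lik P (\<theta> (c i)) (D ! i))"

definition one_hot :: "nat \<Rightarrow> nat \<Rightarrow> (nat \<Rightarrow> nat \<Rightarrow> nat) \<Rightarrow> (nat \<Rightarrow> nat) \<Rightarrow> bool" where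
  "one_hot N k W c \<longleftrightarrow> (\<forall>i<N. c i < k \<and> (\<forall>j<k. W i j = (if j = c i then 1 else 0)))"

lemma action_lik_nonneg: "0 \<le> action_lik P \<eta> \<tau>"
  by (simp add: action_lik_def prod_nonneg)

lemma data_lik_nonneg: "0 \<le> data_lik P D c \<theta>"
  by (simp add: data_lik_def prod_nonneg action_lik_nonneg)

lemma log_prob_mult:
  assumes "0 \<le> p" "0 \<le> q"
  shows "log_prob (p * q) = log_prob p + log_prob q"
  using assms by (auto simp: log_prob_def ln_mult)

lemma log_prob_prod:
  assumes "\<And>x. x \<in> A \<Longrightarrow> 0 \<le> f x"
  shows "log_prob (\<Prod>x\<in>A. f x) = (\<Sum>x\<in>A. log_prob (f x))"
  using assms
  by (induction A rule: infinite_finite_induct)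
    (simp_all add: log_prob_mult prod_nonneg, simp_all add: log_prob_def zero_ereal_def)

lemma log_prob_le_iff:
  assumes "0 \<le> p" "0 \<le> q"
  shows "log_prob p \<le> log_prob q \<longleftrightarrow> p \<le> q"
  using assms by (auto simp: log_prob_def)

lemma objective_eq_log_prob_data_lik:
  assumes "one_hot (length D) k W c"
  shows "objective P D k W \<theta> = log_prob (data_lik P D c \<theta>)"
proof -
  let ?L = "\<lambda>i j. log_prob (action_lik P (\<theta> j) (D ! i))"
  have row: "(\<Sum>j<k. ereal (real (W i j)) * ?L i j) = ?L i (c i)" if "i < length D" for i
  proof -
    have "(\<Sum>j<k. ereal (real (W i j)) * ?L i j) = (\<Sum>j<k. if j = c i then ?L i j else 0)"
      using assms that by (intro sum.cong) (auto simp: one_hot_def)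
    also have "\<dots> = ?L i (c i)"
      using assms that by (simp add: one_hot_def)
    finally show ?thesis .
  qed
  have "objective P D k W \<theta> = (\<Sum>i<length D. \<Sum>j<k. ereal (real (W i j)) * ?L i j)"
    by (simp add: objective_def action_lik_def log_prob_prod)
  also have "\<dots> = (\<Sum>i<length D. ?L i (c i))"
    by (simp add: row)
  also have "\<dots> = log_prob (data_lik P D c \<theta>)"
    by (simp add: data_lik_def log_prob_prod action_lik_nonneg)
  finally show ?thesis .
qed

lemma M_step_iff:
  assumes "one_hot (length D) k W c"
  shows "M_step P D k W \<theta> \<longleftrightarrow> (\<forall>\<theta>'. data_lik P D c \<theta>' \<le> data_lik P D c \<theta>)"
  unfolding M_step_def is_arg_max_linorder objective_eq_log_prob_data_lik[OF assms]
  by (simp add: log_prob_le_iff data_lik_nonneg)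

lemma best_cluster_iff:
  assumes "env_prob \<rho> T \<tau> > 0"
  shows "best_cluster \<rho> T P k \<theta> \<tau> j \<longleftrightarrow>
    j < k \<and> (\<forall>j'<k. action_lik P (\<theta> j') \<tau> \<le> action_lik P (\<theta> j) \<tau>)"
  using assms
  by (simp add: best_cluster_def is_arg_max_linorder traj_prob_def flip: action_lik_def)

lemma is_assignment_one_hot:
  assumes "is_assignment N k W"
  shows "\<exists>c. one_hot N k W c"
proof -
  have "\<exists>j. j < k \<and> (\<forall>j'<k. W i j' = (if j' = j then 1 else 0))" if "i < N" for i
  proof -
    from assms that have "(\<Sum>j<k. W i j) = 1"
      by (simp add: is_assignment_def)
    then obtain j where "j < k" "W i j = 1" "\<forall>j'<k. j \<noteq> j' \<longrightarrow> W i j' = 0"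
      by (auto simp: sum_eq_1_iff simp del: One_nat_def)
    then show ?thesis
      by (intro exI[of _ j]) auto
  qed
  then show ?thesis
    unfolding one_hot_def by metis
qed

lemma E_step_one_hot:
  assumes "E_step \<rho> T P D k \<theta> W"
  shows "\<exists>c. one_hot (length D) k W c"
proof -
  have "\<exists>j. j < k \<and> (\<forall>j'<k. W i j' = (if j' = j then 1 else 0))" if "i < length D" for i
    using assms that unfolding E_step_def best_cluster_def is_arg_max_def by blast
  then show ?thesis
    unfolding one_hot_def by metis
qed

lemma E_step_best_cluster:
  assumes "E_step \<rho> T P D k \<theta> W" "one_hot (length D) k W c" "i < length D"
  shows "best_cluster \<rho> T P k \<theta> (D ! i) (c i)"
proof -
  obtain j where j: "best_cluster \<rho> T P k \<theta> (D ! i) j"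
    and W: "\<forall>j'<k. W i j' = (if j' = j then 1 else 0)"
    using assms unfolding E_step_def by blast
  have "j < k"
    using j by (simp add: best_cluster_def is_arg_max_def)
  with W assms have "j = c i"
    unfolding one_hot_def by (metis zero_neq_one)
  with j show ?thesis by simp
qed

lemma prod_eq_imp_eq_if_le:
  fixes f g :: "'b \<Rightarrow> real"
  assumes "finite A" "\<And>x. x \<in> A \<Longrightarrow> 0 \<le> f x" "\<And>x. x \<in> A \<Longrightarrow> f x \<le> g x"
    and "0 < prod f A" "prod f A = prod g A" "y \<in> A"
  shows "f y = g y"
proof (rule ccontr)
  assume "f y \<noteq> g y"
  with assms have less: "f y < g y"
    by (simp add: order_less_le)
  have split: "prod f A = f y * prod f (A - {y})" "prod g A = g y * prod g (A - {y})"
    using assms by (simp_all add: prod.remove)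
  have "prod f (A - {y}) \<le> prod g (A - {y})"
    using assms by (intro prod_mono) auto
  moreover have "0 \<le> f y" "0 \<le> prod f (A - {y})"
    using assms by (auto intro: prod_nonneg)
  moreover from this have "0 < prod f (A - {y})"
    using assms(4) split(1) by (auto simp: order_less_le)
  ultimately have "prod f A < prod g A"
    unfolding split using less by (intro mult_less_le_imp_less) auto
  with assms(5) show False by simp
qed

lemma iteration_progress:
  assumes env: "\<forall>\<tau>\<in>set D. env_prob \<rho> T \<tau> > 0"
    and r: "inj_on r {..<k}"
    and c: "one_hot (length D) k W c" and c': "one_hot (length D) k W' c'"
    and E: "E_step \<rho> T P D k \<theta> W'"
    and ties: "consistent_ties r \<rho> T P D k \<theta> W W'"
    and changed: "\<not> same_assignment (length D) k W' W"
    and pos: "0 < data_lik P D c \<theta>"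
  shows "data_lik P D c \<theta> < data_lik P D c' \<theta> \<or>
    data_lik P D c \<theta> = data_lik P D c' \<theta> \<and> (\<Sum>i<length D. r (c' i)) < (\<Sum>i<length D. r (c i))"
proof -
  let ?q = "\<lambda>c i. action_lik P (\<theta> (c i)) (D ! i)"
  have k: "c i < k" "c' i < k" if "i < length D" for i
    using c c' that by (auto simp: one_hot_def)
  have best: "action_lik P (\<theta> j) (D ! i) \<le> ?q c' i" if "i < length D" "j < k" for i j
    using E_step_best_cluster[OF E c' that(1)] env that by (simp add: best_cluster_iff)
  have le: "?q c i \<le> ?q c' i" if "i < length D" for i
    using best k that by simp
  have "data_lik P D c \<theta> \<le> data_lik P D c' \<theta>"
    unfolding data_lik_def using le by (intro prod_mono) (simp add: action_lik_nonneg)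
  moreover have "(\<Sum>i<length D. r (c' i)) < (\<Sum>i<length D. r (c i))"
    if eq: "data_lik P D c \<theta> = data_lik P D c' \<theta>"
  proof -
    have q_eq: "?q c i = ?q c' i" if "i < length D" for i
    proof (rule prod_eq_imp_eq_if_le[where f = "?q c" and g = "?q c'" and A = "{..<length D}"])
      show "0 < prod (?q c) {..<length D}" "prod (?q c) {..<length D} = prod (?q c') {..<length D}"
        using pos eq by (simp_all add: data_lik_def)
    qed (use le that in \<open>auto simp: action_lik_nonneg\<close>)
    have rank_le: "r (c' i) \<le> r (c i)" if i: "i < length D" for i
    proof -
      have "best_cluster \<rho> T P k \<theta> (D ! i) (c i)"
        using best[OF i] k[OF i] env i by (simp add: best_cluster_iff q_eq)
      moreover have "W i (c i) = 1" "W' i (c' i) = 1"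
        using c c' i by (simp_all add: one_hot_def)
      ultimately show ?thesis
        using ties k[OF i] i unfolding consistent_ties_def by blast
    qed
    have "\<exists>i<length D. c' i \<noteq> c i"
    proof (rule ccontr)
      assume "\<not> (\<exists>i<length D. c' i \<noteq> c i)"
      with c c' have "same_assignment (length D) k W' W"
        by (simp add: one_hot_def same_assignment_def)
      with changed show False ..
    qed
    then obtain i where i: "i < length D" "c' i \<noteq> c i" by blast
    then have "r (c' i) \<noteq> r (c i)"
      using r k by (auto dest: inj_onD)
    with rank_le[OF i(1)] have "r (c' i) < r (c i)" by simp
    with i rank_le show ?thesis
      by (intro sum_strict_mono_ex1) auto
  qed
  ultimately show ?thesis by linarith
qed

lemma pg_kmeans_converges:
  assumes env: "\<forall>\<tau>\<in>set D. env_prob \<rho> T \<tau> > 0"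
    and r: "inj_on r {..<k}"
    and run: "pg_kmeans_run r \<rho> T P D k W \<theta>"
    and init: "objective P D k (W 0) (\<theta> 0) > - \<infinity>"
  shows "\<exists>t\<le>k ^ length D. converged_at D k W t"
proof (rule ccontr)
  define N where "N = length D"
  assume "\<not> ?thesis"
  then have nc: "\<not> converged_at D k W t" if "t \<le> k ^ N" for t
    using that by (auto simp: N_def)
  have step: "M_step P D k (W t) (\<theta> (Suc t))" "E_step \<rho> T P D k (\<theta> (Suc t)) (W (Suc t))"
    "consistent_ties r \<rho> T P D k (\<theta> (Suc t)) (W t) (W (Suc t))" if "t \<le> k ^ N" for t
    using run nc that unfolding pg_kmeans_run_def by (meson le_trans)+
  have "\<exists>c. one_hot N k (W t) c" if "t \<le> k ^ N" for t
  proof (cases t)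
    case 0
    with run show ?thesis
      unfolding N_def by (auto simp: pg_kmeans_run_def intro: is_assignment_one_hot)
  next
    case (Suc u)
    with that step(2)[of u] show ?thesis
      unfolding N_def by (auto intro: E_step_one_hot)
  qed
  then obtain c where c: "\<And>t. t \<le> k ^ N \<Longrightarrow> one_hot N k (W t) (c t)"
    by metis
  define a where "a t = data_lik P D (c t) (\<theta> (Suc t))" for t
  define R where "R t = (\<Sum>i<N. r (c t i))" for t
  have a_max: "data_lik P D (c t) \<theta>' \<le> a t" if "t \<le> k ^ N" for t \<theta>'
    using step(1)[OF that] c[OF that] by (simp add: M_step_iff a_def N_def)

  have "data_lik P D (c 0) (\<theta> 0) \<noteq> 0"
    using init c[of 0] by (auto simp: objective_eq_log_prob_data_lik N_def log_prob_def)
  with a_max[of 0 "\<theta> 0"] have a0: "0 < a 0"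
    using data_lik_nonneg[of P D "c 0" "\<theta> 0"] by simp
  have succ: "a t < a (Suc t) \<or> a t = a (Suc t) \<and> R (Suc t) < R t"
    if t: "Suc t \<le> k ^ N" and "0 < a t" for t
  proof -
    have "\<not> same_assignment (length D) k (W (Suc t)) (W t)"
      using nc[OF t] by (simp add: converged_at_def)
    then have "a t < data_lik P D (c (Suc t)) (\<theta> (Suc t)) \<or>
      a t = data_lik P D (c (Suc t)) (\<theta> (Suc t)) \<and> R (Suc t) < R t"
      using iteration_progress[OF env r, of "W t" "c t" "W (Suc t)" "c (Suc t)"] c[of t] c[OF t]
        step[of t] t \<open>0 < a t\<close> by (simp add: a_def R_def N_def)
    with a_max[OF t, of "\<theta> (Suc t)"] show ?thesis by linarith
  qed
  have a_pos: "0 < a t" if "t \<le> k ^ N" for t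
    using that
  proof (induction t)
    case (Suc t)
    then show ?case using succ[of t] by auto
  qed (rule a0)
  have less: "a s < a t \<or> a s = a t \<and> R t < R s" if "s < t" "t \<le> k ^ N" for s t
    using that
  proof (induction t)
    case (Suc t)
    from Suc.prems have "s = t \<or> s < t" by auto
    then show ?case
      using Suc succ[of t] a_pos[of t] by fastforce
  qed simp

  have "inj_on (\<lambda>t. restrict (c t) {..<N}) {..k ^ N}"
  proof (rule linorder_inj_onI')
    fix s t assume st: "s \<in> {..k ^ N}" "t \<in> {..k ^ N}" "s < t"
    show "restrict (c s) {..<N} \<noteq> restrict (c t) {..<N}"
    proof
      assume "restrict (c s) {..<N} = restrict (c t) {..<N}"
      then have eq: "c s i = c t i" if "i < N" for i
        using that by (metis lessThan_iff restrict_apply')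
      then have lik_eq: "data_lik P D (c s) \<theta>' = data_lik P D (c t) \<theta>'" for \<theta>'
        by (simp add: data_lik_def N_def)
      have "a s = a t"
        using a_max[of s "\<theta> (Suc t)"] a_max[of t "\<theta> (Suc s)"] st
        by (simp add: a_def lik_eq)
      moreover have "R s = R t"
        by (simp add: R_def eq)
      ultimately show False
        using less[of s t] st by simp
    qed
  qed
  moreover have "(\<lambda>t. restrict (c t) {..<N}) ` {..k ^ N} \<subseteq> {..<N} \<rightarrow>\<^sub>E {..<k}"
    using c by (auto simp: one_hot_def split: if_splits)
  ultimately have "card {..k ^ N} \<le> card ({..<N} \<rightarrow>\<^sub>E {..<k})"
    by (intro card_inj_on_le) (auto intro: finite_PiE)
  then show False
    by (simp add: card_PiE)
qed

theorem theoremA1: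
  shows "\<exists>C::real. C > 0 \<and>
    (\<forall>(\<rho> :: 's pmf) (T :: 's \<Rightarrow> 'a \<Rightarrow> 's pmf) (P :: 'p \<Rightarrow> 's \<Rightarrow> 'a pmf)
      (N :: nat) (H :: nat) (k :: nat) (D :: ('s, 'a) trajectory list) (r :: nat \<Rightarrow> nat)
      (W :: nat \<Rightarrow> nat \<Rightarrow> nat \<Rightarrow> nat) (\<theta> :: nat \<Rightarrow> nat \<Rightarrow> 'p).
      1 \<le> N \<longrightarrow> 1 \<le> H \<longrightarrow> 1 \<le> k \<longrightarrow>
      length D = N \<longrightarrow> (\<forall>\<tau>\<in>set D. length \<tau> = H \<and> env_prob \<rho> T \<tau> > 0) \<longrightarrow>
      inj_on r {..<k} \<longrightarrow>
      pg_kmeans_run r \<rho> T P D k W \<theta> \<longrightarrow>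
      objective P D k (W 0) (\<theta> 0) > - \<infinity> \<longrightarrow>
      (\<exists>t. converged_at D k W t \<and> real t \<le> C * real (k ^ N)))"
proof (rule exI[where x = 1], intro conjI allI impI)
  fix \<rho> :: "'s pmf" and T :: "'s \<Rightarrow> 'a \<Rightarrow> 's pmf" and P :: "'p \<Rightarrow> 's \<Rightarrow> 'a pmf"
    and N H k :: nat and D :: "('s, 'a) trajectory list" and r :: "nat \<Rightarrow> nat"
    and W :: "nat \<Rightarrow> nat \<Rightarrow> nat \<Rightarrow> nat" and \<theta> :: "nat \<Rightarrow> nat \<Rightarrow> 'p"
  assume "length D = N" "\<forall>\<tau>\<in>set D. length \<tau> = H \<and> env_prob \<rho> T \<tau> > 0"
    "inj_on r {..<k}" "pg_kmeans_run r \<rho> T P D k W \<theta>" "objective P D k (W 0) (\<theta> 0) > - \<infinity>"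
  then obtain t where "t \<le> k ^ N" "converged_at D k W t"
    using pg_kmeans_converges[of D \<rho> T r k P W \<theta>] by auto
  then show "\<exists>t. converged_at D k W t \<and> real t \<le> 1 * real (k ^ N)"
    by (auto simp del: of_nat_power)
qed simp

end
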